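(* Let $n\ge 1$ be an integer and let $P>1$ be a fixed integer. Let $\mathcal{N}^{\mathrm{adapt}}_{n,P}$ be the set of all functions $K:[0,1]^n\to\mathbb{R}$ realized by P1-ICKAN networks with adapted grids and $P$ mesh intervals per input coordinate in every layer, where the depth $L\ge 1$, the widths $n_0,\dots,n_{L-1}\ge 1$ and all trainable parameters (including the grid parameters) are allowed to vary. Then $\mathcal{N}^{\mathrm{adapt}}_{n,P}$ is dense, with respect to the sup norm, in the set of Lipschitz convex functions on $[0,1]^n$; that is, for every Lipschitz convex function $f:[0,1]^n\to\mathbb{R}$ and every $\epsilon>0$ there exists $K\in\mathcal{N}^{\mathrm{adapt}}_{n,P}$ such that $\sup_{x\in[0,1]^n}|f(x)-K(x)|<\epsilon$.
   Context: **One-dimensional building block.** Let $P\ge1$ be an integer, $\underline g\le\bar g$ reals, and $\underline g=\hat x_0\le\hat x_1\le\dots\le\hat x_P=\bar g$ a grid of $[\underline g,\bar g]$ (strictly increasing if $\underline g<\bar g$). Given real parameters $b,\ c,\ d_1,\dots,d_{P-1}$, define nodal values $$a_p=b+\sum_{s=1}^{p}\Bigl(c+\sum_{i=1}^{s-1}\max(d_i,0)\Bigr)(\hat x_s-\hat x_{s-1}),\qquad p=0,\dots,P,$$ and let $\phi:[\underline g,\bar g]\to\mathbb{R}$ be the continuous function that is affine on each $[\hat x_{p-1},\hat x_p]$ with $\phi(\hat x_p)=a_p$ (if $\underline g=\bar g$, $\phi$ is the constant $b$). Equivalently $\phi=\sum_{p=0}^P a_p\Psi_p$ with $\Psi_p$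 the P1 hat functions of the grid. **Grids (adapted version).** For an interval $[\underline g,\bar g]$ and trainable reals $e_1,\dots,e_P>0$, the grid is $\hat x_0=\underline g$ and $$\hat x_p=\underline g+(\bar g-\underline g)\,\frac{\sum_{k=1}^p e_k}{\sum_{k=1}^P e_k},\qquad p=1,\dots,P.$$ **Layers.** Fix a depth $L\ge1$ and widths $n_0,\dots,n_{L-1}\ge1$; set $n_{-1}=n$ and $n_L=1$. Put $G^0=[0,1]^n$. For $l=0,\dots,L$, layer $l$ has as input domain a hyperrectangle $G^l=\prod_{j=1}^{n_{l-1}}[\underline G^l_j,\bar G^l_j]$. For each input coordinate $j$, choose trainable parameters $e_{l,j,1},\dots,e_{l,j,P}>0$ and let $(\hat x_{l,j,p})_{p=0,\dots,P}$ be the grid of $[\underline G^l_j,\bar G^l_j]$ given by $\hat x_{l,j,0}=\underline G^l_j$ and $$\hat x_{l,j,p}=\underline G^l_j+(\bar G^l_j-\underline G^l_j)\,\frac{\sum_{k=1}^p e_{l,j,k}}{\sum_{k=1}^P e_{l,j,k}},\qquad p=1,\dots,P$$ (the grid depends on $l$ and $j$ but not on the output index). For $k=1,\dots,n_l$ and $j=1,\dots,n_{l-1}$ choose trainable reals $b_{l,k,j},\hat b_{l,k,j},d_{l,k,j,1},\dots,d_{l,k,j,P-1}$, and let $\phi_{l,k,j}$ be the building block on this grid with $b=b_{l,k,j}$, $d_i=d_{l,k,j,i}$, and $$c=\hat b_{0,k,j}\ \text{ if } l=0,\qquad c=\max(\hat b_{l,k,j},0)\ \text{ if } l\ge1.$$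 Let $a_{l,k,j,p}=\phi_{l,k,j}(\hat x_{l,j,p})$ be its nodal values. The layer map is $$\hat\kappa^l(x)_k=\sum_{j=1}^{n_{l-1}}\phi_{l,k,j}(x_j),\qquad x\in G^l,\ k=1,\dots,n_l,$$ and the input domain of the next layer is $G^{l+1}=\prod_{k=1}^{n_l}[\underline G^{l+1}_k,\bar G^{l+1}_k]$ with $$\underline G^{l+1}_k=\sum_{j=1}^{n_{l-1}}\min_{0\le p\le P}a_{l,k,j,p},\qquad \bar G^{l+1}_k=\sum_{j=1}^{n_{l-1}}\max(a_{l,k,j,0},a_{l,k,j,P}).$$ One has $\hat\kappa^l(G^l)\subset G^{l+1}$, so the layers can be composed. **Network.** The P1-ICKAN function with these parameters is $K=\hat\kappa^L\circ\hat\kappa^{L-1}\circ\dots\circ\hat\kappa^0:[0,1]^n\to\mathbb{R}$. All $b_{l,k,j},\hat b_{l,k,j},d_{l,k,j,i}\in\mathbb{R}$ and all $e_{l,j,p}>0$ are free. *)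

theory Defs
  imports "HOL-Analysis.Analysis"
begin

text \<open>
  Mesh indices run from 0 to P as usual, so the grid parameters \<open>e\<close> are used at the indices
  \<open>1, \<dots>, P\<close> and the parameters \<open>d\<close> at \<open>1, \<dots>, P - 1\<close>.  Coordinates of layer inputs and outputs
  are counted from 0, i.e. a vector of length \<open>m\<close> is a function on \<open>nat\<close> of which only the values
  on \<open>{..<m}\<close> are used.  An interval is represented by its pair of end points.
\<close>

definition grid :: "nat \<Rightarrow> (nat \<Rightarrow> real) \<Rightarrow> real \<times> real \<Rightarrow> nat \<Rightarrow> real" where
  "grid P e I p = fst I + (snd I - fst I) * ((\<Sum>k=1..p. e k) / (\<Sum>k=1..P. e k))"

definition nodal_value ::
  "(nat \<Rightarrow> real) \<Rightarrow> real \<Rightarrow> real \<Rightarrow> (nat \<Rightarrow> real) \<Rightarrow> nat \<Rightarrow> real" where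
  "nodal_value t b c d p =
     b + (\<Sum>s=1..p. (c + (\<Sum>i=1..s-1. max (d i) 0)) * (t s - t (s - 1)))"

text \<open>
  On the cell \<open>[t (p - 1), t p]\<close> the interpolant is the affine function through the two
  nodal values.  The least \<open>p\<close> only selects one of the two cells at an interior node, where both
  formulas agree; see \<open>p1_interp_cell\<close> below.
\<close>

definition p1_interp :: "(nat \<Rightarrow> real) \<Rightarrow> (nat \<Rightarrow> real) \<Rightarrow> real \<Rightarrow> real" where
  "p1_interp t a x =
     (let p = (LEAST p. 1 \<le> p \<and> x \<le> t p)
      in a (p - 1) + (a p - a (p - 1)) * ((x - t (p - 1)) / (t p - t (p - 1))))"

definition building_block ::
  "real \<times> real \<Rightarrow> (nat \<Rightarrow> real) \<Rightarrow> real \<Rightarrow> real \<Rightarrow> (nat \<Rightarrow> real) \<Rightarrow> real \<Rightarrow> real" where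
  "building_block I t b c d x =
     (if fst I = snd I then b else p1_interp t (nodal_value t b c d) x)"

text \<open>
  \<open>width N l\<close> is the input dimension of layer \<open>l\<close>, that is, \<open>n\<^sub>l\<^sub>-\<^sub>1\<close> in the usual numbering; the
  output dimension of layer \<open>l\<close> is \<open>width N (Suc l)\<close>.  The argument order is
  \<open>par_b N l k j\<close>, \<open>par_bhat N l k j\<close>, \<open>par_d N l k j i\<close> and \<open>par_e N l j p\<close>, with layer \<open>l\<close>, output
  coordinate \<open>k\<close> and input coordinate \<open>j\<close>.
\<close>

record ickan =
  depth :: nat
  width :: "nat \<Rightarrow> nat"
  par_b :: "nat \<Rightarrow> nat \<Rightarrow> nat \<Rightarrow> real"
  par_bhat :: "nat \<Rightarrow> nat \<Rightarrow> nat \<Rightarrow> real"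
  par_d :: "nat \<Rightarrow> nat \<Rightarrow> nat \<Rightarrow> nat \<Rightarrow> real"
  par_e :: "nat \<Rightarrow> nat \<Rightarrow> nat \<Rightarrow> real"

definition par_c :: "ickan \<Rightarrow> nat \<Rightarrow> nat \<Rightarrow> nat \<Rightarrow> real" where
  "par_c N l k j = (if l = 0 then par_bhat N 0 k j else max (par_bhat N l k j) 0)"

text \<open>Nodal values of the block \<open>(l, k, j)\<close> when its input interval is \<open>I\<close>.\<close>

definition node :: "nat \<Rightarrow> ickan \<Rightarrow> nat \<Rightarrow> nat \<Rightarrow> nat \<Rightarrow> real \<times> real \<Rightarrow> nat \<Rightarrow> real" where
  "node P N l k j I p =
     nodal_value (grid P (par_e N l j) I) (par_b N l k j) (par_c N l k j) (par_d N l k j) p"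

primrec layer_domain :: "nat \<Rightarrow> ickan \<Rightarrow> nat \<Rightarrow> nat \<Rightarrow> real \<times> real" where
  "layer_domain P N 0 = (\<lambda>j. (0, 1))"
| "layer_domain P N (Suc l) = (\<lambda>k.
     (\<Sum>j<width N l. Min ((\<lambda>p. node P N l k j (layer_domain P N l j) p) ` {0..P}),
      \<Sum>j<width N l. max (node P N l k j (layer_domain P N l j) 0) (node P N l k j (layer_domain P N l j) P)))"

definition edge :: "nat \<Rightarrow> ickan \<Rightarrow> nat \<Rightarrow> nat \<Rightarrow> nat \<Rightarrow> real \<Rightarrow> real" where
  "edge P N l k j =
     building_block (layer_domain P N l j) (grid P (par_e N l j) (layer_domain P N l j))
       (par_b N l k j) (par_c N l k j) (par_d N l k j)"

definition layer :: "nat \<Rightarrow> ickan \<Rightarrow> nat \<Rightarrow> (nat \<Rightarrow> real) \<Rightarrow> nat \<Rightarrow> real" where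
  "layer P N l x k = (\<Sum>j<width N l. edge P N l k j (x j))"

text \<open>\<open>layers P N m\<close> is the composition of the first \<open>m\<close> layers \<open>0, \<dots>, m - 1\<close>.\<close>

primrec layers :: "nat \<Rightarrow> ickan \<Rightarrow> nat \<Rightarrow> (nat \<Rightarrow> real) \<Rightarrow> nat \<Rightarrow> real" where
  "layers P N 0 x = x"
| "layers P N (Suc m) x = layer P N m (layers P N m x)"

definition network :: "nat \<Rightarrow> ickan \<Rightarrow> (nat \<Rightarrow> real) \<Rightarrow> real" where
  "network P N x = layers P N (Suc (depth N)) x 0"

definition valid_ickan :: "nat \<Rightarrow> nat \<Rightarrow> ickan \<Rightarrow> bool" where
  "valid_ickan n P N \<longleftrightarrow>
     1 \<le> depth N \<and> width N 0 = n \<and> (\<forall>l\<in>{1..depth N}. 1 \<le> width N l) \<and>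
     width N (Suc (depth N)) = 1 \<and>
     (\<forall>l\<le>depth N. \<forall>j<width N l. \<forall>p\<in>{1..P}. 0 < par_e N l j p)"

text \<open>
  The coordinates of a vector in \<open>real ^ 'n\<close> in the order of the library enumeration of the finite
  type \<open>'n\<close>, which is a bijection on \<open>{..<CARD('n)}\<close> (\<open>bij_betw_from_nat_into_finite\<close>).  All
  parameters are free, so the class of networks does not depend on the order.
\<close>

definition coords :: "real ^ 'n::finite \<Rightarrow> nat \<Rightarrow> real" where
  "coords x j = x $ from_nat_into UNIV j"

text \<open>
  The functions on the unit cube \<open>cbox 0 1\<close> realised by a network.  Their values outside the cube
  are irrelevant and left arbitrary.
\<close>

definition ickan_adapt :: "nat \<Rightarrow> (real ^ 'n::finite \<Rightarrow> real) set" where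
  "ickan_adapt P =
     {K. \<exists>N. valid_ickan CARD('n) P N \<and> (\<forall>x\<in>cbox 0 1. K x = network P N (coords x))}"

text \<open>
  The interpolant is the affine one on every cell of a strictly increasing grid; in particular it
  takes the prescribed nodal values.
\<close>

lemma p1_interp_cell:
  assumes mono: "\<And>r s. r < s \<Longrightarrow> s \<le> P \<Longrightarrow> t r < t s"
    and p: "p \<in> {1..P}" and x: "x \<in> {t (p - 1)..t p}"
  shows "p1_interp t a x = a (p - 1) + (a p - a (p - 1)) * ((x - t (p - 1)) / (t p - t (p - 1)))"
proof -
  define q where "q = (LEAST p. 1 \<le> p \<and> x \<le> t p)"
  have q: "1 \<le> q" "x \<le> t q" and qp: "q \<le> p"
    using LeastI[of "\<lambda>p. 1 \<le> p \<and> x \<le> t p" p] Least_le[of "\<lambda>p. 1 \<le> p \<and> x \<le> t p" p] p x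
    unfolding q_def by auto
  show ?thesis
  proof (cases "q = p")
    case True
    then show ?thesis unfolding p1_interp_def q_def[symmetric] by simp
  next
    case False
    have "q \<le> p - 1" "p - 1 \<le> P" using False qp p by auto
    have "\<not> q < p - 1"
      using mono[of q "p - 1"] \<open>p - 1 \<le> P\<close> q x by auto
    then have eq: "q = p - 1" using \<open>q \<le> p - 1\<close> by simp
    then have xe: "x = t q" using q x by auto
    have "t (q - 1) < t q" using mono[of "q - 1" q] q eq \<open>p - 1 \<le> P\<close> by auto
    then show ?thesis
      unfolding p1_interp_def q_def[symmetric] Let_def using eq xe by simp
  qed
qed

lemma p1_interp_node:
  assumes mono: "\<And>r s. r < s \<Longrightarrow> s \<le> P \<Longrightarrow> t r < t s" and P: "1 \<le> P" and p: "p \<le> P"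
  shows "p1_interp t a (t p) = a p"
proof (cases "p = 0")
  case True
  have "t 0 < t 1" using mono[of 0 1] P by simp
  then have "p1_interp t a (t 0) = a (1 - 1) + (a 1 - a (1 - 1)) * ((t 0 - t (1 - 1)) / (t 1 - t (1 - 1)))"
    by (intro p1_interp_cell[where P = P] mono) (use P in auto)
  then have "p1_interp t a (t 0) = a 0" by simp
  then show ?thesis using True by simp
next
  case False
  then have less: "t (p - 1) < t p" using mono[of "p - 1" p] p by auto
  then have "p1_interp t a (t p) =
      a (p - 1) + (a p - a (p - 1)) * ((t p - t (p - 1)) / (t p - t (p - 1)))"
    by (intro p1_interp_cell[where P = P] mono) (use False p in auto)
  then show ?thesis using less by simp
qed

lemma grid_strict_mono:
  assumes e: "\<And>k. k \<in> {1..P} \<Longrightarrow> 0 < e k" and I: "fst I < snd I" and "r < s" "s \<le> P"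
  shows "grid P e I r < grid P e I s"
proof -
  have "(\<Sum>k=1..r. e k) < (\<Sum>k=1..s. e k)"
    by (rule sum_strict_mono2[of _ _ s]) (use assms in \<open>auto intro: less_imp_le\<close>)
  moreover have "0 < (\<Sum>k=1..P. e k)"
    by (rule sum_pos) (use assms in auto)
  ultimately show ?thesis
    using I by (simp add: grid_def divide_strict_right_mono)
qed

end

theory Submission
  imports Defs
begin

text \<open>
  A continuous convex function on the cube is, up to \<open>\<epsilon>\<close>, a maximum of finitely many affine
  minorants \<open>A\<^sub>0, \<dots>, A\<^sub>m\<close> (separation from the closed epigraph, then compactness), and a network
  represents such a maximum exactly: the adapted grid can put a node at 0, so every edge can
  realise \<open>\<alpha> + \<beta> x + \<gamma> max(0, x)\<close> without error.  Layer 0, whose slopes are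
  unconstrained, computes \<open>A\<^sub>k - A\<^sub>k\<^sub>+\<^sub>1\<close> (with \<open>A\<^sub>m\<^sub>+\<^sub>1 = 0\<close>), and every further layer maps
  \<open>(S\<^sub>0, S\<^sub>1, S\<^sub>2, \<dots>)\<close> to \<open>(S\<^sub>1 + max(0, S\<^sub>0), S\<^sub>2, S\<^sub>3, \<dots>)\<close>, which is convex and nondecreasing.
  After \<open>l\<close> of these layers the first coordinate is \<open>max(A\<^sub>0, \<dots>, A\<^sub>l) - A\<^sub>l\<^sub>+\<^sub>1\<close>.
\<close>

section \<open>Hinge functions realised exactly by building blocks\<close>

definition hinge :: "real \<Rightarrow> real \<Rightarrow> real \<Rightarrow> real \<Rightarrow> real" where
  "hinge \<alpha> \<beta> \<gamma> x = \<alpha> + \<beta> * x + \<gamma> * max 0 x"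

text \<open>If 0 is interior to the interval, the first cell gets length \<open>- fst I\<close> and
  the other \<open>P - 1\<close> cells share \<open>snd I\<close>. These lengths add up to the
  length of the interval, so the normalisation in \<open>grid\<close> leaves node 1 at 0.\<close>

definition hinge_mesh :: "nat \<Rightarrow> real \<times> real \<Rightarrow> nat \<Rightarrow> real" where
  "hinge_mesh P I i =
     (if fst I < 0 \<and> 0 < snd I then if i = 1 then - fst I else snd I / (real P - 1) else 1)"

text \<open>The slope on the first cell, i.e. the parameter \<open>c\<close>: an interval starting
  at or right of 0 has \<gamma> in its slope from the outset.\<close>

definition hinge_slope :: "real \<Rightarrow> real \<Rightarrow> real \<times> real \<Rightarrow> real" where
  "hinge_slope \<beta> \<gamma> I = \<beta> + (if 0 \<le> fst I then \<gamma> else 0)"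

text \<open>\<open>d 1\<close> changes the slope at node 1, which the mesh puts at 0 when 0 is
  interior; otherwise there is no kink to realise.\<close>

definition hinge_kink :: "real \<Rightarrow> real \<times> real \<Rightarrow> nat \<Rightarrow> real" where
  "hinge_kink \<gamma> I i = (if i = 1 \<and> fst I < 0 \<and> 0 < snd I then \<gamma> else 0)"

lemma grid_0 [simp]: "grid P e I 0 = fst I"
  by (simp add: grid_def)

lemma grid_last:
  assumes "1 \<le> P" "\<And>k. k \<in> {1..P} \<Longrightarrow> 0 < e k"
  shows "grid P e I P = snd I"
proof -
  have "0 < (\<Sum>k=1..P. e k)"
    by (rule sum_pos) (use assms in auto)
  then show ?thesis by (simp add: grid_def)
qed

lemma grid_mono:
  assumes "\<And>k. k \<in> {1..P} \<Longrightarrow> 0 < e k" "fst I \<le> snd I" "r \<le> s" "s \<le> P"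
  shows "grid P e I r \<le> grid P e I s"
proof (cases "fst I < snd I \<and> r < s")
  case True
  then show ?thesis using grid_strict_mono[of P e I r s] assms by auto
next
  case False
  then have "fst I = snd I \<or> r = s" using assms by auto
  then show ?thesis by (auto simp: grid_def)
qed

lemma hinge_mesh_pos: "1 < P \<Longrightarrow> 0 < hinge_mesh P I i"
  by (auto simp: hinge_mesh_def)

lemma hinge_grid_last: "1 < P \<Longrightarrow> grid P (hinge_mesh P I) I P = snd I"
  by (intro grid_last hinge_mesh_pos) auto

lemma hinge_grid_mono:
  "\<lbrakk>1 < P; fst I \<le> snd I; r \<le> s; s \<le> P\<rbrakk> \<Longrightarrow>
    grid P (hinge_mesh P I) I r \<le> grid P (hinge_mesh P I) I s"
  by (intro grid_mono hinge_mesh_pos) auto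

lemma hinge_grid_bounds:
  assumes "1 < P" "fst I \<le> snd I" "p \<le> P"
  shows "fst I \<le> grid P (hinge_mesh P I) I p" "grid P (hinge_mesh P I) I p \<le> snd I"
  using hinge_grid_mono[OF assms(1,2), of 0 p] hinge_grid_mono[OF assms(1,2), of p P]
    hinge_grid_last[of P I] assms by auto

lemma hinge_grid_1:
  assumes "1 < P" "fst I < 0" "0 < snd I"
  shows "grid P (hinge_mesh P I) I 1 = 0"
proof -
  have "(\<Sum>k=1..P. hinge_mesh P I k) = hinge_mesh P I 1 + (\<Sum>k=2..P. hinge_mesh P I k)"
    using assms(1) sum.atLeast_Suc_atMost[of 1 P "hinge_mesh P I"] by (simp add: numeral_2_eq_2)
  also have "(\<Sum>k=2..P. hinge_mesh P I k) = (\<Sum>k=2..P. snd I / (real P - 1))"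
    by (rule sum.cong) (use assms in \<open>auto simp: hinge_mesh_def\<close>)
  also have "\<dots> = snd I"
    using assms by (simp add: of_nat_diff)
  finally have "(\<Sum>k=1..P. hinge_mesh P I k) = snd I - fst I"
    using assms by (simp add: hinge_mesh_def)
  moreover have "snd I - fst I \<noteq> 0" using assms by auto
  ultimately show ?thesis
    using assms by (simp add: grid_def hinge_mesh_def)
qed

text \<open>As no cell straddles 0, a hinge is affine on every cell and P1 interpolation loses
  nothing.\<close>

lemma hinge_grid_cell:
  assumes "1 < P" "fst I \<le> snd I" "p < P"
  shows "grid P (hinge_mesh P I) I (Suc p) \<le> 0 \<or> 0 \<le> grid P (hinge_mesh P I) I p"
proof (cases "fst I < 0 \<and> 0 < snd I")
  case True
  then have "grid P (hinge_mesh P I) I 1 = 0" using hinge_grid_1 assms by blast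
  then show ?thesis
    using hinge_grid_mono[OF assms(1,2), of 1 p] assms by (cases p) auto
next
  case False
  then show ?thesis
    using hinge_grid_bounds(1)[OF assms(1,2), of p] hinge_grid_bounds(2)[OF assms(1,2), of "Suc p"]
      assms by auto
qed

lemma sum_hinge_kink:
  "(\<Sum>i=1..p. max (hinge_kink \<gamma> I i) 0) =
    (if 1 \<le> p \<and> fst I < 0 \<and> 0 < snd I then max \<gamma> 0 else 0)"
  by (induction p) (auto simp: hinge_kink_def)

text \<open>Induction along the nodes, comparing increments cell by cell. By
  \<open>0 \<le> \<gamma>\<close> the truncation \<open>max (d i) 0\<close> in
  \<open>nodal_value\<close> changes nothing.\<close>

lemma nodal_value_hinge:
  assumes "1 < P" "fst I \<le> snd I" "0 \<le> \<gamma>" "p \<le> P"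
  defines "t \<equiv> grid P (hinge_mesh P I) I"
  shows "nodal_value t (hinge \<alpha> \<beta> \<gamma> (fst I)) (hinge_slope \<beta> \<gamma> I) (hinge_kink \<gamma> I) p =
    hinge \<alpha> \<beta> \<gamma> (t p)"
  using assms(4)
proof (induction p)
  case 0
  then show ?case by (simp add: nodal_value_def t_def)
next
  case (Suc p)
  have b: "fst I \<le> t p" "t (Suc p) \<le> snd I" "t p \<le> t (Suc p)"
    using hinge_grid_bounds[OF assms(1,2)] hinge_grid_mono[OF assms(1,2), of p "Suc p"] Suc.prems
    by (auto simp: t_def)
  \<comment> \<open>When 0 is interior, node 1 is 0, so the first cell has slope \<beta> and all
    later cells \<beta> + \<gamma>. Otherwise the hinge is affine on the whole interval.\<close>
  have "(hinge_slope \<beta> \<gamma> I + (if 1 \<le> p \<and> fst I < 0 \<and> 0 < snd I then \<gamma> else 0)) *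
      (t (Suc p) - t p) = hinge \<alpha> \<beta> \<gamma> (t (Suc p)) - hinge \<alpha> \<beta> \<gamma> (t p)"
  proof (cases "fst I < 0 \<and> 0 < snd I")
    case True
    then have t1: "t 1 = 0" using hinge_grid_1 assms(1) by (auto simp: t_def)
    show ?thesis
    proof (cases p)
      case 0
      then show ?thesis using t1 True by (simp add: hinge_def hinge_slope_def t_def algebra_simps)
    next
      case (Suc q)
      then have "0 \<le> t p" using t1 hinge_grid_mono[OF assms(1,2), of 1 p] \<open>Suc p \<le> P\<close>
        by (auto simp: t_def)
      then show ?thesis using True Suc b by (simp add: hinge_def hinge_slope_def algebra_simps)
    qed
  next
    case False
    show ?thesis
    proof (cases "0 \<le> fst I")
      case True
      then show ?thesis using b by (simp add: hinge_def hinge_slope_def algebra_simps)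
    next
      case neg: False
      then have "max 0 (t p) = 0" "max 0 (t (Suc p)) = 0" using b False by auto
      then show ?thesis using neg False by (simp add: hinge_def hinge_slope_def algebra_simps)
    qed
  qed
  moreover have "nodal_value t b c d (Suc p) =
      nodal_value t b c d p + (c + (\<Sum>i=1..p. max (d i) 0)) * (t (Suc p) - t p)" for b c d
    by (simp add: nodal_value_def)
  moreover have "(\<Sum>i=1..p. max (hinge_kink \<gamma> I i) 0) =
      (if 1 \<le> p \<and> fst I < 0 \<and> 0 < snd I then \<gamma> else 0)"
    unfolding sum_hinge_kink using assms(3) by simp
  ultimately show ?case using Suc by simp
qed

lemma building_block_hinge:
  assumes P: "1 < P" and "0 \<le> \<gamma>" and x: "x \<in> {fst I..snd I}"
  shows "building_block I (grid P (hinge_mesh P I) I) (hinge \<alpha> \<beta> \<gamma> (fst I))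
    (hinge_slope \<beta> \<gamma> I) (hinge_kink \<gamma> I) x = hinge \<alpha> \<beta> \<gamma> x"
proof (cases "fst I = snd I")
  case True
  then show ?thesis using x by (simp add: building_block_def)
next
  case False
  define t where "t = grid P (hinge_mesh P I) I"
  define a where "a = nodal_value t (hinge \<alpha> \<beta> \<gamma> (fst I)) (hinge_slope \<beta> \<gamma> I) (hinge_kink \<gamma> I)"
  have lt: "fst I < snd I" and le: "fst I \<le> snd I" using False x by auto
  have mono: "t r < t s" if "r < s" "s \<le> P" for r s
    unfolding t_def by (rule grid_strict_mono) (use that lt P hinge_mesh_pos in auto)
  have "t P = snd I" using hinge_grid_last P by (simp add: t_def)
  have "\<exists>p\<in>{1..P}. x \<in> {t (p - 1)..t p}"
  proof -
    \<comment> \<open>The least node not left of \<open>x\<close> ends the cell sought; index 0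
      means \<open>x = fst I\<close>, for which the first cell is taken.\<close>
    define p where "p = (LEAST p. x \<le> t p)"
    have "x \<le> t P" using \<open>t P = snd I\<close> x by simp
    then have p: "x \<le> t p" "p \<le> P"
      unfolding p_def by (rule LeastI, rule Least_le)
    have p_min: "t q < x" if "q < p" for q
      using not_less_Least[OF that[unfolded p_def]] by simp
    show ?thesis
    proof (cases p)
      case 0
      then have "x \<in> {t (1 - 1)..t 1}" using p x mono[of 0 1] P by (auto simp: t_def)
      then show ?thesis using P by (intro bexI[of _ 1]) auto
    next
      case (Suc q)
      then have "x \<in> {t (p - 1)..t p}" using p(1) p_min[of q] by auto
      then show ?thesis using Suc p by (intro bexI[of _ p]) auto
    qed
  qed
  then obtain p where p: "p \<in> {1..P}" "x \<in> {t (p - 1)..t p}" by blast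
  define q where "q = p - 1"
  have q: "Suc q \<le> P" "t q \<le> x" "x \<le> t (Suc q)" using p by (auto simp: q_def)
  have "p1_interp t a x = a q + (a (Suc q) - a q) * ((x - t q) / (t (Suc q) - t q))"
    using p1_interp_cell[of P t "Suc q" x a] mono q by auto
  also have "\<dots> = hinge \<alpha> \<beta> \<gamma> (t q) +
      (hinge \<alpha> \<beta> \<gamma> (t (Suc q)) - hinge \<alpha> \<beta> \<gamma> (t q)) * ((x - t q) / (t (Suc q) - t q))"
    using nodal_value_hinge[OF P le \<open>0 \<le> \<gamma>\<close>] q by (simp add: a_def t_def)
  also have "\<dots> = hinge \<alpha> \<beta> \<gamma> x"
  proof -
    have "\<exists>m k. \<forall>y\<in>{t q..t (Suc q)}. hinge \<alpha> \<beta> \<gamma> y = k + m * y"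
    proof (cases "t (Suc q) \<le> 0")
      case True
      then have "\<forall>y\<in>{t q..t (Suc q)}. hinge \<alpha> \<beta> \<gamma> y = \<alpha> + \<beta> * y" by (auto simp: hinge_def)
      then show ?thesis by blast
    next
      case False
      then have "0 \<le> t q" using hinge_grid_cell[OF P le, of q] q by (auto simp: t_def)
      then have "\<forall>y\<in>{t q..t (Suc q)}. hinge \<alpha> \<beta> \<gamma> y = \<alpha> + (\<beta> + \<gamma>) * y"
        by (auto simp: hinge_def algebra_simps)
      then show ?thesis by blast
    qed
    then obtain m k where "\<forall>y\<in>{t q..t (Suc q)}. hinge \<alpha> \<beta> \<gamma> y = k + m * y" by blast
    then have eq: "hinge \<alpha> \<beta> \<gamma> y = k + m * y" if "t q \<le> y" "y \<le> t (Suc q)" for y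
      using that by auto
    have "t q < t (Suc q)" using mono q by auto
    moreover have "(k + m * t (Suc q)) - (k + m * t q) = m * (t (Suc q) - t q)"
      by (simp add: algebra_simps)
    ultimately have "hinge \<alpha> \<beta> \<gamma> (t q) + (hinge \<alpha> \<beta> \<gamma> (t (Suc q)) - hinge \<alpha> \<beta> \<gamma> (t q)) *
        ((x - t q) / (t (Suc q) - t q)) = (k + m * t q) + m * (x - t q)"
      using q by (simp add: eq)
    then show ?thesis using q by (simp add: eq right_diff_distrib)
  qed
  finally show ?thesis using False by (simp add: building_block_def a_def t_def)
qed

text \<open>Such a hinge is monotone: nondecreasing if \<open>0 \<le> \<beta>\<close>, and otherwise
  affine and decreasing, as then \<open>\<gamma> = 0\<close>. The two alternatives fit layer 0
  (affine edges of any slope) and the later layers (nonnegative slopes).\<close>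

lemma hinge_between:
  assumes "0 \<le> \<gamma>" "\<gamma> = 0 \<or> 0 \<le> \<beta>" "x \<in> {u..v}"
  shows "hinge \<alpha> \<beta> \<gamma> x \<in> {min (hinge \<alpha> \<beta> \<gamma> u) (hinge \<alpha> \<beta> \<gamma> v)..max (hinge \<alpha> \<beta> \<gamma> u) (hinge \<alpha> \<beta> \<gamma> v)}"
proof (cases "0 \<le> \<beta>")
  case True
  have "hinge \<alpha> \<beta> \<gamma> y \<le> hinge \<alpha> \<beta> \<gamma> z" if "y \<le> z" for y z
    unfolding hinge_def by (intro add_mono mult_left_mono) (use that True assms in auto)
  then show ?thesis using assms(3) by (simp add: min.coboundedI1 max.coboundedI2)
next
  case False
  then have "hinge \<alpha> \<beta> \<gamma> z \<le> hinge \<alpha> \<beta> \<gamma> y" if "y \<le> z" for y z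
    using assms(2) that by (auto simp: hinge_def mult_left_mono_neg)
  then show ?thesis using assms(3) by (simp add: min.coboundedI2 max.coboundedI1)
qed

section \<open>Networks all of whose edges are hinges\<close>

locale hinge_net =
  fixes P :: nat and w :: "nat \<Rightarrow> nat" and \<alpha> \<beta> \<gamma> :: "nat \<Rightarrow> nat \<Rightarrow> nat \<Rightarrow> real"
  assumes P: "1 < P"
    and \<gamma>_nonneg: "\<And>l k j. 0 \<le> \<gamma> l k j"
    and \<gamma>_0: "\<And>k j. \<gamma> 0 k j = 0"
    and \<beta>_nonneg: "\<And>l k j. 0 < l \<Longrightarrow> 0 \<le> \<beta> l k j"
begin

abbreviation h :: "nat \<Rightarrow> nat \<Rightarrow> nat \<Rightarrow> real \<Rightarrow> real" where
  "h l k j \<equiv> hinge (\<alpha> l k j) (\<beta> l k j) (\<gamma> l k j)"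

text \<open>The composition of the target edges without grids or domains; \<open>layers_net\<close>
  shows that the network computes it on the cube.\<close>

primrec run :: "nat \<Rightarrow> (nat \<Rightarrow> real) \<Rightarrow> nat \<Rightarrow> real" where
  "run 0 x = x"
| "run (Suc l) x = (\<lambda>k. \<Sum>j<w l. h l k j (run l x j))"

text \<open>
  The parameters of a layer depend on its input domain, which in turn depends on the parameters
  of the earlier layers; computing the domains from the target edges alone breaks this circle.
\<close>

primrec domain :: "nat \<Rightarrow> nat \<Rightarrow> real \<times> real" where
  "domain 0 = (\<lambda>j. (0, 1))"
| "domain (Suc l) = (\<lambda>k.
     (\<Sum>j<w l. min (h l k j (fst (domain l j))) (h l k j (snd (domain l j))),
      \<Sum>j<w l. max (h l k j (fst (domain l j))) (h l k j (snd (domain l j)))))"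

text \<open>All kinks sit at 0, so the mesh depends only on the input interval and can be shared by
  all outputs \<open>k\<close>, as \<open>par_e\<close> requires.\<close>

definition net :: "nat \<Rightarrow> ickan" where
  "net m = \<lparr>depth = m, width = w,
     par_b = \<lambda>l k j. h l k j (fst (domain l j)),
     par_bhat = \<lambda>l k j. hinge_slope (\<beta> l k j) (\<gamma> l k j) (domain l j),
     par_d = \<lambda>l k j. hinge_kink (\<gamma> l k j) (domain l j),
     par_e = \<lambda>l j. hinge_mesh P (domain l j)\<rparr>"

lemma domain_le: "fst (domain l j) \<le> snd (domain l j)"
  by (induction l arbitrary: j) (auto intro!: sum_mono simp: min_def max_def)

text \<open>Layer 0 has no truncation of \<open>par_bhat\<close>, and in later layers the prescribed
  slope is already nonnegative.\<close>

lemma par_c_net: "par_c (net m) l k j = hinge_slope (\<beta> l k j) (\<gamma> l k j) (domain l j)"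
proof (cases "l = 0")
  case False
  then have "0 \<le> hinge_slope (\<beta> l k j) (\<gamma> l k j) (domain l j)"
    using \<gamma>_nonneg \<beta>_nonneg by (simp add: hinge_slope_def)
  then show ?thesis using False by (simp add: par_c_def net_def)
qed (simp add: par_c_def net_def)

lemma node_net:
  assumes "p \<le> P"
  shows "node P (net m) l k j (domain l j) p =
    h l k j (grid P (hinge_mesh P (domain l j)) (domain l j) p)"
  unfolding node_def par_c_net
  using nodal_value_hinge[OF P domain_le \<gamma>_nonneg assms] by (simp add: net_def)

lemma h_between:
  assumes "x \<in> {fst (domain l j)..snd (domain l j)}"
  shows "h l k j x \<in> {min (h l k j (fst (domain l j))) (h l k j (snd (domain l j)))..
    max (h l k j (fst (domain l j))) (h l k j (snd (domain l j)))}"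
  by (intro hinge_between \<gamma>_nonneg assms) (use \<gamma>_0 \<beta>_nonneg in \<open>cases l; auto\<close>)

text \<open>Induction on the layer. The minimum over all nodes is attained at an end node, because
  by \<open>h_between\<close> no inner node goes below both end values.\<close>

lemma layer_domain_net: "layer_domain P (net m) l = domain l"
proof (induction l)
  case (Suc l)
  have last: "node P (net m) l k j (domain l j) P = h l k j (snd (domain l j))" for k j
    using node_net[of P m l k j] hinge_grid_last[OF P] by simp
  have first: "node P (net m) l k j (domain l j) 0 = h l k j (fst (domain l j))" for k j
    using node_net[of 0 m l k j] by simp
  have "Min (node P (net m) l k j (domain l j) ` {0..P}) =
      min (h l k j (fst (domain l j))) (h l k j (snd (domain l j)))" for k j
  proof (rule Min_eqI)
    fix y assume "y \<in> node P (net m) l k j (domain l j) ` {0..P}"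
    then obtain p where "p \<le> P" "y = h l k j (grid P (hinge_mesh P (domain l j)) (domain l j) p)"
      using node_net by auto
    then show "min (h l k j (fst (domain l j))) (h l k j (snd (domain l j))) \<le> y"
      using h_between hinge_grid_bounds[OF P domain_le] by auto
  next
    show "min (h l k j (fst (domain l j))) (h l k j (snd (domain l j)))
        \<in> node P (net m) l k j (domain l j) ` {0..P}"
      using first[of k j, symmetric] last[of k j, symmetric] by (auto simp: min_def)
  qed simp
  then show ?case
    unfolding layer_domain.simps Suc.IH domain.simps first last by (simp add: net_def)
qed simp

lemma edge_net:
  assumes "x \<in> {fst (domain l j)..snd (domain l j)}"
  shows "edge P (net m) l k j x = h l k j x"
  unfolding edge_def layer_domain_net par_c_net
  using building_block_hinge[OF P \<gamma>_nonneg assms] by (simp add: net_def)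

text \<open>Equality and range go through one induction, since an edge agrees with its hinge only on
  its input interval.\<close>

lemma layers_net:
  assumes "\<And>j. j < w 0 \<Longrightarrow> x j \<in> {0..1}"
  shows "\<forall>k<w l. layers P (net m) l x k = run l x k \<and>
    run l x k \<in> {fst (domain l k)..snd (domain l k)}"
proof (induction l)
  case 0
  then show ?case using assms by auto
next
  case (Suc l)
  have "layers P (net m) (Suc l) x k = run (Suc l) x k" for k
    using Suc edge_net by (auto simp: layer_def net_def intro!: sum.cong)
  moreover have "run (Suc l) x k \<in> {fst (domain (Suc l) k)..snd (domain (Suc l) k)}" for k
    using h_between Suc by (auto intro!: sum_mono)
  ultimately show ?case by blast
qed

lemma network_net:
  assumes "\<And>j. j < w 0 \<Longrightarrow> x j \<in> {0..1}" "w (Suc m) = 1"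
  shows "network P (net m) x = run (Suc m) x 0"
  using layers_net[OF assms(1), where l = "Suc m" and m = m] assms(2) by (simp add: network_def net_def)

lemma valid_net:
  assumes "1 \<le> m" "w 0 = n" "\<And>l. l \<in> {1..m} \<Longrightarrow> 1 \<le> w l" "w (Suc m) = 1"
  shows "valid_ickan n P (net m)"
  using assms P hinge_mesh_pos by (simp add: valid_ickan_def net_def)

end

section \<open>Maxima of affine functions as networks\<close>

lemma sum_from_nat_into:
  "(\<Sum>j<CARD('n::finite). g (from_nat_into (UNIV :: 'n set) j)) = (\<Sum>i\<in>UNIV. g i)"
  using sum.reindex_bij_betw[OF bij_betw_from_nat_into_finite[of "UNIV :: 'n set"], of g] by simp

text \<open>Layer 0 forms the differences and each of the layers 1 to \<open>m\<close> absorbs one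
  more affine function; \<open>1 \<le> m\<close> because this \<open>m\<close> is the depth.\<close>

lemma max_affine_ickan:
  fixes v :: "nat \<Rightarrow> real ^ 'n::finite" and a :: "nat \<Rightarrow> real"
  assumes P: "1 < P" and m: "1 \<le> m"
  shows "\<exists>N. valid_ickan CARD('n) P N \<and>
    (\<forall>x\<in>cbox 0 1. network P N (coords x) = Max ((\<lambda>i. a i + v i \<bullet> x) ` {..m}))"
proof -
  define A :: "nat \<Rightarrow> real ^ 'n \<Rightarrow> real" where "A i x = (if i \<le> m then a i + v i \<bullet> x else 0)" for i x
  define b where "b i = (if i \<le> m then a i else 0)" for i
  define u where "u i = (if i \<le> m then v i else 0)" for i
  \<comment> \<open>\<open>A (Suc m) = 0\<close>, so that the last telescoping difference is \<open>A m\<close> itself.\<close>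
  have A_eq: "A i x = b i + u i \<bullet> x" for i x by (simp add: A_def b_def u_def)
  \<comment> \<open>An output of layer 0 sums \<open>CARD('n)\<close> edges, so its constant is
    split evenly among them.\<close>
  define \<alpha> :: "nat \<Rightarrow> nat \<Rightarrow> nat \<Rightarrow> real" where
    "\<alpha> l k j = (if l = 0 then (b k - b (Suc k)) / CARD('n) else 0)" for l k j
  \<comment> \<open>In later layers output \<open>k\<close> copies input \<open>Suc k\<close>, a
    shift by one coordinate.\<close>
  define \<beta> :: "nat \<Rightarrow> nat \<Rightarrow> nat \<Rightarrow> real" where
    "\<beta> l k j = (if l = 0 then (u k - u (Suc k)) $ from_nat_into UNIV j
      else if j = Suc k then 1 else 0)" for l k j
  define \<gamma> :: "nat \<Rightarrow> nat \<Rightarrow> nat \<Rightarrow> real" where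
    "\<gamma> l k j = (if l \<noteq> 0 \<and> k = 0 \<and> j = 0 then 1 else 0)" for l k j
  \<comment> \<open>The width is \<open>m + 1\<close> after layer 0 and drops by one per layer,
    reaching 1 after layer \<open>m\<close>; the shift therefore always finds its input
    \<open>Suc k\<close>.\<close>
  define w where "w l = (if l = 0 then CARD('n) else m + 2 - l)" for l
  interpret hinge_net P w \<alpha> \<beta> \<gamma>
    by unfold_locales (use P in \<open>auto simp: \<beta>_def \<gamma>_def\<close>)
  \<comment> \<open>Coordinate 0 carries the running maximum; the others are the original
    differences, shifted by \<open>l\<close>.\<close>
  have run: "run (Suc l) (coords x) 0 = Max ((\<lambda>i. A i x) ` {..l}) - A (Suc l) x \<and>
      (\<forall>k. 0 < k \<longrightarrow> k < w (Suc l) \<longrightarrow> run (Suc l) (coords x) k = A (k + l) x - A (Suc (k + l)) x)"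
    if "l \<le> m" for l x
    using that
  proof (induction l)
    case 0
    have "run 1 (coords x) k = A k x - A (Suc k) x" for k
    proof -
      have "run 1 (coords x) k =
          (\<Sum>j<CARD('n). \<alpha> 0 k j + (u k - u (Suc k)) $ from_nat_into UNIV j * x $ from_nat_into UNIV j)"
        by (simp add: w_def hinge_def \<beta>_def \<gamma>_def coords_def)
      also have "\<dots> = (b k - b (Suc k)) + (u k - u (Suc k)) \<bullet> x"
        unfolding sum.distrib sum_from_nat_into[where g = "\<lambda>i. (u k - u (Suc k)) $ i * x $ i"]
        by (simp add: \<alpha>_def inner_vec_def)
      also have "\<dots> = A k x - A (Suc k) x" by (simp add: A_eq inner_diff_left)
      finally show ?thesis .
    qed
    then show ?case by simp
  next
    case (Suc l)
    let ?r = "run (Suc l) (coords x)"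
    have step: "run (Suc (Suc l)) (coords x) k = ?r (Suc k) + (if k = 0 then max 0 (?r 0) else 0)"
      if "k < w (Suc (Suc l))" for k
    proof -
      have kw: "Suc k < w (Suc l)" using that by (auto simp: w_def)
      have "run (Suc (Suc l)) (coords x) k =
          (\<Sum>j<w (Suc l). (if j = Suc k then ?r j else 0) +
            (if j = 0 then if k = 0 then max 0 (?r j) else 0 else 0))"
        unfolding run.simps(2)[of "Suc l"]
        by (rule sum.cong) (auto simp: hinge_def \<alpha>_def \<beta>_def \<gamma>_def)
      also have "\<dots> = ?r (Suc k) + (if k = 0 then max 0 (?r 0) else 0)"
        unfolding sum.distrib using kw by (simp del: run.simps)
      finally show ?thesis .
    qed
    have IH: "?r 0 = Max ((\<lambda>i. A i x) ` {..l}) - A (Suc l) x"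
      "\<And>k. 0 < k \<Longrightarrow> k < w (Suc l) \<Longrightarrow> ?r k = A (k + l) x - A (Suc (k + l)) x"
      using Suc by auto
    have "1 < w (Suc l)" "0 < w (Suc (Suc l))" using Suc.prems by (auto simp: w_def)
    then have "run (Suc (Suc l)) (coords x) 0 = A (Suc l) x - A (Suc (Suc l)) x +
        max 0 (Max ((\<lambda>i. A i x) ` {..l}) - A (Suc l) x)"
      using step[of 0] IH by (simp del: run.simps)
    \<comment> \<open>With \<open>M\<close> the old maximum,
      \<open>A (Suc l) x + max 0 (M - A (Suc l) x)\<close> is the larger of the two.\<close>
    also have "\<dots> = Max ((\<lambda>i. A i x) ` {..Suc l}) - A (Suc (Suc l)) x"
      by (simp add: atMost_Suc max_def)
    finally have "run (Suc (Suc l)) (coords x) 0 =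
        Max ((\<lambda>i. A i x) ` {..Suc l}) - A (Suc (Suc l)) x" .
    moreover have "run (Suc (Suc l)) (coords x) k = A (k + Suc l) x - A (Suc (k + Suc l)) x"
      if "0 < k" "k < w (Suc (Suc l))" for k
      using step[of k] IH(2)[of "Suc k"] that by (simp add: w_def del: run.simps)
    ultimately show ?case by blast
  qed
  have "valid_ickan CARD('n) P (net m)"
    by (rule valid_net) (use m in \<open>auto simp: w_def\<close>)
  moreover have "network P (net m) (coords x) = Max ((\<lambda>i. a i + v i \<bullet> x) ` {..m})"
    if "x \<in> cbox 0 1" for x :: "real ^ 'n"
  proof -
    have "coords x j \<in> {0..1}" for j
      using that by (auto simp: coords_def mem_box_cart)
    then have "network P (net m) (coords x) = run (Suc m) (coords x) 0"
      by (intro network_net) (auto simp: w_def)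
    also have "\<dots> = Max ((\<lambda>i. A i x) ` {..m})" using run[of m x] by (simp add: A_def del: run.simps)
    also have "(\<lambda>i. A i x) ` {..m} = (\<lambda>i. a i + v i \<bullet> x) ` {..m}" by (auto simp: A_def)
    finally show ?thesis .
  qed
  ultimately show ?thesis by blast
qed

section \<open>Convex functions as approximate maxima of affine minorants\<close>

lemma convex_on_affine_minorant:
  fixes f :: "'a::euclidean_space \<Rightarrow> real"
  assumes "convex_on S f" "continuous_on S f" "closed S" "y \<in> S" "0 < \<epsilon>"
  shows "\<exists>a v. (\<forall>x\<in>S. a + v \<bullet> x \<le> f x) \<and> f y - \<epsilon> < a + v \<bullet> y"
proof -
  have "epigraph S f = {z \<in> S \<times> UNIV. f (fst z) \<le> snd z}"
    by (auto simp: epigraph_def)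
  moreover have "closed {z \<in> S \<times> (UNIV :: real set). f (fst z) \<le> snd z}"
    by (intro continuous_on_closed_Collect_le closed_Times closed_UNIV continuous_intros
        continuous_on_compose2[OF assms(2)] assms(3)) auto
  ultimately have "closed (epigraph S f)" by simp
  moreover have "convex (epigraph S f)"
    using assms(1) convex_epigraph convex_on_imp_convex by blast
  \<comment> \<open>The slack \<epsilon> keeps the point off the closed epigraph, so the separation
    is strict even over boundary points of \<open>S\<close>, where an exact affine support may fail
    to exist.\<close>
  moreover have "(y, f y - \<epsilon>) \<notin> epigraph S f" using assms by (simp add: epigraph_def)
  ultimately obtain n b where n: "n \<bullet> (y, f y - \<epsilon>) < b" "\<forall>z\<in>epigraph S f. b < n \<bullet> z"
    using separating_hyperplane_closed_point by blast
  obtain p s where ps: "n = (p, s)" by (cases n)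
  have up: "b < p \<bullet> x + s * f x" if "x \<in> S" for x
    using n(2)[rule_format, of "(x, f x)"] that by (simp add: ps epigraph_def)
  have lo: "p \<bullet> y + s * (f y - \<epsilon>) < b" using n(1) by (simp add: ps)
  \<comment> \<open>Comparing the points at heights \<open>f y\<close> and
    \<open>f y - \<epsilon>\<close> over \<open>y\<close> shows that the hyperplane is not vertical;
    dividing by \<open>s\<close> turns it into the graph of an affine function.\<close>
  have "0 < s * \<epsilon>" using up[OF assms(4)] lo by (simp add: algebra_simps)
  then have s: "0 < s" using assms(5) by (simp add: zero_less_mult_iff)
  have "b / s + (- (1 / s) *\<^sub>R p) \<bullet> x \<le> f x" if "x \<in> S" for x
    using up[OF that] s by (simp add: field_simps)
  moreover have "f y - \<epsilon> < b / s + (- (1 / s) *\<^sub>R p) \<bullet> y"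
    using lo s by (simp add: field_simps)
  ultimately show ?thesis by blast
qed

lemma convex_on_approx_max_affine:
  fixes f :: "'a::euclidean_space \<Rightarrow> real"
  assumes "convex_on S f" "continuous_on S f" "compact S" "S \<noteq> {}" "0 < \<epsilon>"
  shows "\<exists>(a :: nat \<Rightarrow> real) v m. (\<forall>i. \<forall>x\<in>S. a i + v i \<bullet> x \<le> f x) \<and>
    (\<forall>x\<in>S. \<exists>i<m. f x - \<epsilon> < a i + v i \<bullet> x)"
proof -
  have "\<forall>y\<in>S. \<exists>a v. (\<forall>x\<in>S. a + v \<bullet> x \<le> f x) \<and> f y - \<epsilon> < a + v \<bullet> y"
    using convex_on_affine_minorant[OF assms(1,2) compact_imp_closed[OF assms(3)] _ assms(5)] by blast
  then obtain a v where av: "\<And>y x. y \<in> S \<Longrightarrow> x \<in> S \<Longrightarrow> a y + v y \<bullet> x \<le> f x"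
      "\<And>y. y \<in> S \<Longrightarrow> f y - \<epsilon> < a y + v y \<bullet> y"
    by metis
  \<comment> \<open>Continuity on \<open>S\<close> gives only relative openness, so an open set of
    the whole space with the right trace is chosen.\<close>
  have "\<exists>U. open U \<and> U \<inter> S = {x \<in> S. f x - \<epsilon> < a y + v y \<bullet> x}" for y
  proof -
    have "continuous_on S (\<lambda>x. a y + v y \<bullet> x - f x)"
      by (intro continuous_intros assms(2))
    then obtain U where "open U" "U \<inter> S = (\<lambda>x. a y + v y \<bullet> x - f x) -` {-\<epsilon><..} \<inter> S"
      using continuous_on_open_invariant open_greaterThan by metis
    moreover have "\<dots> = {x \<in> S. f x - \<epsilon> < a y + v y \<bullet> x}" by auto
    ultimately show ?thesis by auto
  qed
  then obtain U where U: "\<And>y. open (U y)" "\<And>y. U y \<inter> S = {x \<in> S. f x - \<epsilon> < a y + v y \<bullet> x}"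
    by metis
  have "S \<subseteq> (\<Union>y\<in>S. U y)" using U(2) av(2) by blast
  then obtain T where T: "T \<subseteq> S" "finite T" "S \<subseteq> (\<Union>y\<in>T. U y)"
    using compactE_image[OF assms(3), of S U] U(1) by metis
  then have "T \<noteq> {}" using assms(4) by auto
  \<comment> \<open>\<open>from_nat_into\<close> stays in the nonempty \<open>T\<close> at every
    index, so all terms of the sequence are minorants, also those from \<open>card T\<close>
    on.\<close>
  define c where "c = from_nat_into T"
  have c: "c i \<in> S" for i using from_nat_into[OF \<open>T \<noteq> {}\<close>] T by (auto simp: c_def)
  have "\<exists>i<card T. f x - \<epsilon> < a (c i) + v (c i) \<bullet> x" if x: "x \<in> S" for x
  proof -
    obtain y where y: "y \<in> T" "x \<in> U y" using T x by blast
    moreover have "c ` {..<card T} = T"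
      using bij_betw_from_nat_into_finite[OF T(2)] by (simp add: bij_betw_def c_def)
    ultimately have "y \<in> c ` {..<card T}" by simp
    then obtain i where "i < card T" "c i = y" by (elim imageE) simp
    then show ?thesis using y U(2)[of y] x by blast
  qed
  then show ?thesis
    using av(1) c by (intro exI[of _ "a \<circ> c"] exI[of _ "v \<circ> c"] exI[of _ "card T"]) auto
qed

section \<open>Density in the sup norm\<close>

theorem theorem2p1:
  fixes f :: "real ^ 'n::finite \<Rightarrow> real" and P :: nat and C \<epsilon> :: real
  assumes "P > 1"
    and "convex_on (cbox 0 1) f"
    and "C-lipschitz_on (cbox 0 1) f"
    and "\<epsilon> > 0"
  shows "\<exists>K\<in>ickan_adapt P. bdd_above ((\<lambda>x. \<bar>f x - K x\<bar>) ` cbox 0 1) \<and>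
           (SUP x\<in>cbox 0 1. \<bar>f x - K x\<bar>) < \<epsilon>"
proof -
  have cube: "cbox 0 (1 :: real ^ 'n) \<noteq> {}"
    by (simp add: interval_ne_empty_cart)
  \<comment> \<open>Half of \<epsilon>, because pointwise bounds pass to the supremum only as a
    non-strict inequality.\<close>
  obtain a :: "nat \<Rightarrow> real" and v m where
    below: "\<forall>i. \<forall>x\<in>cbox 0 1. a i + v i \<bullet> x \<le> f x" and
    above: "\<forall>x\<in>cbox 0 1. \<exists>i<m. f x - \<epsilon> / 2 < a i + v i \<bullet> x"
    using convex_on_approx_max_affine[OF assms(2) lipschitz_on_continuous_on[OF assms(3)]
        compact_cbox cube, of "\<epsilon> / 2"] assms(4) half_gt_zero by blast
  \<comment> \<open>\<open>Suc m\<close> ensures depth at least 1. The extra indices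
    \<open>m\<close> and \<open>Suc m\<close> keep the maximum below \<open>f\<close>, as
    \<open>below\<close> holds for every \<open>i\<close>.\<close>
  obtain N where N: "valid_ickan CARD('n) P N"
    "\<And>x. x \<in> cbox 0 1 \<Longrightarrow> network P N (coords x) = Max ((\<lambda>i. a i + v i \<bullet> x) ` {..Suc m})"
    using max_affine_ickan[OF assms(1), of "Suc m" a v] by auto
  define K where "K x = network P N (coords x)" for x :: "real ^ 'n"
  have close: "\<bar>f x - K x\<bar> \<le> \<epsilon> / 2" if x: "x \<in> cbox 0 1" for x
  proof -
    obtain i where i: "i < m" "f x - \<epsilon> / 2 < a i + v i \<bullet> x" using above x by blast
    then have "a i + v i \<bullet> x \<le> K x"
      unfolding K_def N(2)[OF x] by (intro Max_ge) auto
    moreover have "K x \<le> f x"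
      unfolding K_def N(2)[OF x] using below x by (subst Max_le_iff) auto
    ultimately show ?thesis using i by auto
  qed
  have "bdd_above ((\<lambda>x. \<bar>f x - K x\<bar>) ` cbox 0 1)"
    using close by (rule bdd_aboveI2)
  moreover have "(SUP x\<in>cbox 0 1. \<bar>f x - K x\<bar>) \<le> \<epsilon> / 2"
    using close cube by (intro cSUP_least) auto
  moreover have "K \<in> ickan_adapt P"
    using N(1) by (auto simp: ickan_adapt_def K_def)
  ultimately show ?thesis
    using assms(4) by (intro bexI[of _ K]) auto
qed

end
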